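(* Let $0<|q|<1$, let $A,B,C,D$ be nonzero complex numbers with $A,D\notin\{q^{-k}:k\ge0\}$, let $\alpha=\frac12\sqrt{ABCD/q}$, and let $z=x/\alpha$ with $x=\cos\theta$, $u=e^{i\theta}$. Let $P_n(z;A,B,C,D)$ be the monic associated continuous dual $q$-Hahn polynomials. Then $$\sum_{n=0}^\infty\frac{(2\alpha)^nP_n(z;A,B,C,D)}{(A)_n(D)_n}t^n=\frac{\left(\frac{2\alpha tq}{AD}\right)_\infty}{(tu)_\infty}\sum_{n=0}^\infty\sum_{j=0}^n\frac{(\frac{2\alpha u}{B})_n(\frac{2\alpha u}{C})_n}{(A)_n(D)_n}\,\frac{(\frac Aq)_j(\frac Dq)_j(\frac{ADu}{2\alpha})_j}{(\frac{2\alpha u}{B})_j(\frac{2\alpha u}{C})_j(q)_j}\left(\frac{2\alpha q}{AD}\right)^ju^{-n+j}t^n$$ as power series in $t$.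
   Context: Notation: $(a)_\infty=\prod_{j\ge0}(1-aq^j)$, $(a)_n=\prod_{j=0}^{n-1}(1-aq^j)$. The ratio $(a)_n/(a)_j$ for $j\le n$ is read as $(aq^j)_{n-j}$. The monic associated continuous dual $q$-Hahn polynomials $P_n(z)=P_n(z;A,B,C,D)$ are defined by $P_{-1}=0$, $P_0=1$ and, for $n\ge0$, $$P_{n+1}=\Big[z-\Big(\tfrac1A+\tfrac1B+\tfrac1C+\tfrac1D\Big)q^n+(1+q)q^{2n-1}\Big]P_n-\frac{1}{4\alpha^2}(1-Aq^{n-1})(1-Bq^{n-1})(1-Cq^{n-1})(1-Dq^{n-1})P_{n-1}.$$ *)

theory Defs
  imports "HOL-Complex_Analysis.Complex_Analysis"
begin

definition qpoch :: "complex \<Rightarrow> complex \<Rightarrow> nat \<Rightarrow> complex" where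
  "qpoch q a n = (\<Prod>j<n. 1 - a * q ^ j)"

definition qpoch_inf :: "complex \<Rightarrow> complex \<Rightarrow> complex" where
  "qpoch_inf q a = (\<Prod>j. 1 - a * q ^ j)"

text \<open>The ratio of the \<open>q\<close>-shifted factorials of \<open>a\<close> of lengths \<open>n\<close> and \<open>j\<close>, for \<open>j \<le> n\<close>,
  read as the \<open>q\<close>-shifted factorial of \<open>a q\<^sup>j\<close> of length \<open>n - j\<close>, so that it is meaningful even
  when the denominator vanishes.\<close>

definition qpoch_ratio :: "complex \<Rightarrow> complex \<Rightarrow> nat \<Rightarrow> nat \<Rightarrow> complex" where
  "qpoch_ratio q a n j = qpoch q (a * q ^ j) (n - j)"

text \<open>The conditional encodes the convention that the polynomial of index \<open>-1\<close> is \<open>0\<close>.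
  The exponents are integers because \<open>2n - 1\<close> and \<open>n - 1\<close> are negative for \<open>n = 0\<close>.\<close>

fun assoc_cdqHahn ::
  "complex \<Rightarrow> complex \<Rightarrow> complex \<Rightarrow> complex \<Rightarrow> complex \<Rightarrow> complex \<Rightarrow> nat \<Rightarrow> complex \<Rightarrow> complex"
where
  "assoc_cdqHahn q \<alpha> A B C D 0 z = 1"
| "assoc_cdqHahn q \<alpha> A B C D (Suc n) z =
     (z - (1 / A + 1 / B + 1 / C + 1 / D) * q ^ n + (1 + q) * q powi (2 * int n - 1))
       * assoc_cdqHahn q \<alpha> A B C D n z
     - 1 / (4 * \<alpha>\<^sup>2) * (1 - A * q powi (int n - 1)) * (1 - B * q powi (int n - 1))
       * (1 - C * q powi (int n - 1)) * (1 - D * q powi (int n - 1))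
       * (if n = 0 then 0 else assoc_cdqHahn q \<alpha> A B C D (n - 1) z)"

end

(* With s = 2 alpha and kappa = s q / (A D), the recurrence turns the left-hand side into the
   solution G of a second-order q-difference equation in t. Its coefficient of G(q^2 t) is a
   constant times (1 - kappa t) (1 - kappa q t), and the relation s^2 q = A B C D makes the
   coefficient of G(q t) divisible by 1 - kappa t. Hence the substitution
   G(t) = (kappa t)_oo / (t u)_oo F(t) reduces the degree in t to one: the coefficients of F satisfy
   a first-order recurrence whose inhomogeneity is the q-binomial series of
   (t u q)_oo / (kappa t)_oo, and the inner sum over j solves this recurrence. *)

theory Submission
  imports Defs
begin

section \<open>The dilation of formal power series, t to q t\<close>

lemma power_neq_one:
  fixes q :: complex
  assumes "norm q < 1" and "n > 0"
  shows "q ^ n \<noteq> 1"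
proof -
  have "norm (q ^ n) < 1"
    using power_strict_mono[of "norm q" 1 n] assms by (simp add: norm_power)
  then show ?thesis
    by auto
qed

text \<open>Encoding the q-shift as a composition lets multiplicativity and compatibility with
  expansions of analytic functions follow from the general composition rules;
  \<open>fps_dilate_nth\<close> then gives the coefficientwise description.\<close>

definition fps_dilate :: "complex \<Rightarrow> complex fps \<Rightarrow> complex fps" where
  "fps_dilate q F = F oo (fps_const q * fps_X)"

lemma fps_dilate_nth [simp]: "fps_nth (fps_dilate q F) n = q ^ n * fps_nth F n"
  by (simp add: fps_dilate_def fps_compose_linear)

lemma fps_dilate_const [simp]: "fps_dilate q (fps_const c) = fps_const c"
  by (rule fps_ext) simp

lemma fps_dilate_one [simp]: "fps_dilate q 1 = 1"
  by (rule fps_ext) simp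

lemma fps_dilate_X [simp]: "fps_dilate q fps_X = fps_const q * fps_X"
  by (simp add: fps_dilate_def)

lemma fps_dilate_diff: "fps_dilate q (F - G) = fps_dilate q F - fps_dilate q G"
  by (rule fps_ext) (simp add: algebra_simps)

lemma fps_dilate_mult: "fps_dilate q (F * G) = fps_dilate q F * fps_dilate q G"
  by (simp add: fps_dilate_def fps_compose_mult_distrib)

lemma has_fps_expansion_dilate:
  assumes "f has_fps_expansion F"
  shows "(\<lambda>t. f (q * t)) has_fps_expansion fps_dilate q F"
proof -
  have "(f \<circ> (\<lambda>t. q * t)) has_fps_expansion fps_dilate q F"
    unfolding fps_dilate_def
    by (intro has_fps_expansion_compose assms fps_expansion_intros) simp
  then show ?thesis
    by (simp add: o_def)
qed

text \<open>Comparing coefficients leaves a factor \<open>q ^ n - 1\<close>, which is nonzero for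
  positive \<open>n\<close>. This is the uniqueness principle for first-order q-difference equations
  of formal power series.\<close>

lemma fps_dilate_eq_self_imp_const:
  assumes "norm q < 1" and "fps_dilate q F = F"
  shows "F = fps_const (fps_nth F 0)"
proof (rule fps_ext)
  fix n
  have "(q ^ n - 1) * fps_nth F n = 0"
    using arg_cong[OF assms(2), of "\<lambda>F. fps_nth F n"] by (simp add: algebra_simps)
  then show "fps_nth F n = fps_nth (fps_const (fps_nth F 0)) n"
    using power_neq_one[OF assms(1), of n] by (cases "n = 0") auto
qed

section \<open>Finite and infinite q-shifted factorials\<close>

lemma qpoch_0 [simp]: "qpoch q a 0 = 1"
  by (simp add: qpoch_def)

lemma qpoch_Suc: "qpoch q a (Suc n) = qpoch q a n * (1 - a * q ^ n)"
  by (simp add: qpoch_def)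

lemma qpoch_Suc_shift: "qpoch q a (Suc n) = (1 - a) * qpoch q (a * q) n"
  by (simp add: qpoch_def prod.lessThan_Suc_shift mult.assoc del: prod.lessThan_Suc)

lemma qpoch_nonzero:
  assumes "q \<noteq> 0" and "\<And>k::nat. a \<noteq> 1 / q ^ k"
  shows "qpoch q a n \<noteq> 0"
  using assms by (auto simp: qpoch_def field_simps)

lemma qpoch_ratio_self [simp]: "qpoch_ratio q a n n = 1"
  by (simp add: qpoch_ratio_def)

lemma qpoch_ratio_Suc:
  assumes "j \<le> n"
  shows "qpoch_ratio q a (Suc n) j = qpoch_ratio q a n j * (1 - a * q ^ n)"
  using assms by (simp add: qpoch_ratio_def Suc_diff_le qpoch_Suc mult.assoc flip: power_add)

lemma convergent_prod_qpoch:
  assumes "norm q < 1"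
  shows "convergent_prod (\<lambda>j. 1 - a * q ^ j :: complex)"
proof -
  have "summable (\<lambda>j. norm (a * q ^ j))"
    using assms by (simp add: norm_mult norm_power)
  then have "abs_convergent_prod (\<lambda>j. 1 - a * q ^ j)"
    by (simp add: abs_convergent_prod_conv_summable)
  then show ?thesis
    by (rule abs_convergent_prod_imp_convergent_prod)
qed

lemma qpoch_inf_0 [simp]: "qpoch_inf q 0 = 1"
  by (simp add: qpoch_inf_def)

lemma qpoch_inf_unfold:
  assumes "norm q < 1"
  shows "qpoch_inf q a = (1 - a) * qpoch_inf q (q * a)"
proof -
  have "(\<lambda>j. 1 - a * q ^ j) has_prod
          ((\<Prod>j<1. 1 - a * q ^ j) * (\<Prod>j. 1 - a * q ^ (j + 1)))"
    by (rule has_prod_ignore_initial_segment') (rule convergent_prod_qpoch[OF assms])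
  then show ?thesis
    unfolding qpoch_inf_def by (simp add: has_prod_iff mult_ac)
qed

text \<open>The partial products are polynomials in \<open>a\<close>, and on each disc about 0 the
  deviations of their factors from 1 are dominated by a geometric series. Hence they converge
  locally uniformly, and the limit is entire.\<close>

lemma holomorphic_qpoch_inf:
  assumes "norm q < 1"
  shows "qpoch_inf q holomorphic_on UNIV"
proof -
  have lim: "uniform_limit (cball 0 R) (\<lambda>n a. \<Prod>j<n. 1 - a * q ^ j) (qpoch_inf q) sequentially" for R
  proof -
    have "uniformly_convergent_on (cball 0 R) (\<lambda>n a. \<Prod>j<n. 1 - a * q ^ j)"
    proof (rule uniformly_convergent_on_prod')
      show "uniformly_convergent_on (cball 0 R) (\<lambda>n a. \<Sum>j<n. norm (1 - a * q ^ j - 1))"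
      proof (rule Weierstrass_m_test')
        show "summable (\<lambda>j. \<bar>R\<bar> * norm q ^ j)"
          using assms by (intro summable_mult summable_geometric) simp
      qed (auto simp: norm_mult norm_power intro!: mult_right_mono)
    qed (auto intro!: continuous_intros)
    then have "uniform_limit (cball 0 R) (\<lambda>n a. \<Prod>j<n. 1 - a * q ^ j)
        (\<lambda>a. lim (\<lambda>n. \<Prod>j<n. 1 - a * q ^ j)) sequentially"
      by (simp add: uniformly_convergent_uniform_limit_iff)
    moreover have "lim (\<lambda>n. \<Prod>j<n. 1 - a * q ^ j) = qpoch_inf q a" for a
      unfolding qpoch_inf_def using convergent_prod_LIMSEQ[OF convergent_prod_qpoch[OF assms]]
      by (intro limI) (simp only: LIMSEQ_lessThan_iff_atMost)
    ultimately show ?thesis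
      by simp
  qed
  show ?thesis
  proof (rule holomorphic_uniform_sequence)
    fix a :: complex
    have "cball a 1 \<subseteq> cball 0 (norm a + 1)"
      by (simp add: cball_subset_cball_iff dist_norm)
    with lim[of "norm a + 1"]
    show "\<exists>d>0. cball a d \<subseteq> UNIV \<and>
        uniform_limit (cball a d) (\<lambda>n a. \<Prod>j<n. 1 - a * q ^ j) (qpoch_inf q) sequentially"
      using uniform_limit_on_subset zero_less_one by blast
  qed (auto intro!: holomorphic_intros)
qed

section \<open>Power series of quotients of infinite products and their functional equations\<close>

text \<open>Numerator and denominator are entire in \<open>t\<close>, and the denominator equals 1
  at the origin, so the quotient is analytic there.\<close>

lemma has_fps_expansion_qpoch_inf_quotient:
  assumes "norm q < 1"
  shows "(\<lambda>t. qpoch_inf q (a * t) / qpoch_inf q (b * t)) has_fps_expansion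
           fps_expansion (\<lambda>t. qpoch_inf q (a * t) / qpoch_inf q (b * t)) 0"
proof -
  have entire: "(\<lambda>t. qpoch_inf q (c * t)) analytic_on S" for c S
  proof -
    have "(\<lambda>t. qpoch_inf q (c * t)) holomorphic_on UNIV"
      using holomorphic_on_compose_gen[OF _ holomorphic_qpoch_inf[OF assms], of "\<lambda>t. c * t" UNIV]
      by (auto simp: o_def intro!: holomorphic_intros)
    then show ?thesis
      using analytic_on_subset[of _ UNIV S] by (simp add: analytic_on_open)
  qed
  show ?thesis
    by (intro analytic_at_imp_has_fps_expansion_0 analytic_on_divide entire) simp
qed

text \<open>Splitting off the first factor of both products gives the equation for the functions
  near 0; uniqueness of expansions transfers it to the formal series.\<close>

lemma fps_qpoch_inf_quotient:
  fixes q a b :: complex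
  assumes "norm q < 1"
  defines "W \<equiv> fps_expansion (\<lambda>t. qpoch_inf q (a * t) / qpoch_inf q (b * t)) 0"
  shows "fps_nth W 0 = 1"
    and "(1 - fps_const a * fps_X) * fps_dilate q W = (1 - fps_const b * fps_X) * W"
proof -
  define w where "w t = qpoch_inf q (a * t) / qpoch_inf q (b * t)" for t
  have w: "w has_fps_expansion W"
    unfolding w_def W_def by (rule has_fps_expansion_qpoch_inf_quotient[OF assms(1)])
  show "fps_nth W 0 = 1"
    by (simp add: W_def fps_expansion_def)
  \<comment> \<open>Only a neighbourhood of 0 matters for the expansion, and there the factor
    \<open>1 - b * t\<close> can be cancelled from the denominator of \<open>w t\<close>.\<close>
  have "((\<lambda>t. 1 - b * t) \<longlongrightarrow> 1 - b * 0) (nhds 0)"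
    by (intro tendsto_intros filterlim_ident)
  then have "\<forall>\<^sub>F t in nhds 0. 1 - b * t \<noteq> 0"
    by (rule tendsto_imp_eventually_ne) simp
  then have ev: "\<forall>\<^sub>F t in nhds 0. (1 - a * t) * w (q * t) = (1 - b * t) * w t"
  proof eventually_elim
    case (elim t)
    then show ?case
      using qpoch_inf_unfold[OF assms(1), of "a * t"] qpoch_inf_unfold[OF assms(1), of "b * t"]
      by (simp add: w_def mult_ac)
  qed
  have lhs: "(\<lambda>t. (1 - a * t) * w (q * t)) has_fps_expansion
      (1 - fps_const a * fps_X) * fps_dilate q W"
    by (intro fps_expansion_intros has_fps_expansion_dilate w)
  have "(\<lambda>t. (1 - b * t) * w t) has_fps_expansion (1 - fps_const b * fps_X) * W"
    by (intro fps_expansion_intros w)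
  then have "(\<lambda>t. (1 - a * t) * w (q * t)) has_fps_expansion (1 - fps_const b * fps_X) * W"
    using has_fps_expansion_cong[OF ev refl] by blast
  with lhs show "(1 - fps_const a * fps_X) * fps_dilate q W = (1 - fps_const b * fps_X) * W"
    by (rule fps_expansion_unique_complex)
qed

text \<open>The two equations make the product on the left invariant under dilation, hence constant,
  with constant term 1. This stands in for the q-binomial theorem: it identifies \<open>V\<close>
  with the inverse of \<open>(1 - u t) W\<close> without summing any series.\<close>

lemma fps_inverse_of_functional_equations:
  fixes q \<kappa> u :: complex
  assumes "norm q < 1"
    and W: "(1 - fps_const \<kappa> * fps_X) * fps_dilate q W = (1 - fps_const u * fps_X) * W"
    and V: "(1 - fps_const \<kappa> * fps_X) * V = (1 - fps_const (u * q) * fps_X) * fps_dilate q V"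
    and "fps_nth W 0 = 1" and "fps_nth V 0 = 1"
  shows "(1 - fps_const u * fps_X) * W * V = 1"
proof -
  define K U where "K = 1 - fps_const \<kappa> * fps_X" and "U = 1 - fps_const u * fps_X"
  define Y where "Y = U * W * V"
  have "K \<noteq> 0"
    using arg_cong[of K 0 "\<lambda>F. fps_nth F 0"] by (auto simp: K_def)
  have "fps_dilate q U = 1 - fps_const (u * q) * fps_X"
    by (simp add: U_def fps_dilate_diff fps_dilate_mult flip: fps_const_mult)
  then have "K * fps_dilate q Y
      = (K * fps_dilate q W) * ((1 - fps_const (u * q) * fps_X) * fps_dilate q V)"
    by (simp add: Y_def fps_dilate_mult mult_ac)
  also have "\<dots> = (U * W) * (K * V)"
    using W V by (simp add: K_def U_def)
  also have "\<dots> = K * Y"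
    by (simp add: Y_def mult_ac)
  finally have "fps_dilate q Y = Y"
    using \<open>K \<noteq> 0\<close> by simp
  then have "Y = fps_const (fps_nth Y 0)"
    using fps_dilate_eq_self_imp_const[OF assms(1)] by blast
  also have "fps_nth Y 0 = 1"
    using assms by (simp add: Y_def U_def)
  finally show ?thesis
    by (simp add: Y_def U_def)
qed

section \<open>The gauge transformation of the second-order q-difference equation\<close>

text \<open>Each dilation of \<open>W\<close> trades a linear factor in \<kappa> for one in
  \<open>u\<close>, so the \<kappa>-factors in the coefficients are absorbed and
  \<open>(1 - u t) W\<close> can be pulled out of the whole left side. What remains is the equation
  for \<open>F\<close>, and \<open>V\<close> cancels the factor pulled out.\<close>

lemma qdiff_equation_gauge:
  fixes q \<kappa> u v a l b c :: complex
  assumes W: "(1 - fps_const \<kappa> * fps_X) * fps_dilate q W = (1 - fps_const u * fps_X) * W"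
    and V: "(1 - fps_const u * fps_X) * W * V = 1"
    and F: "(1 - fps_const v * fps_X) * F - (fps_const a - fps_const l * fps_X) * fps_dilate q F
      + fps_const b * (1 - fps_const (u * q) * fps_X) * fps_dilate q (fps_dilate q F)
      = fps_const c * V"
  defines "G \<equiv> W * F"
  shows "(1 - fps_const u * fps_X) * (1 - fps_const v * fps_X) * G
      - (1 - fps_const \<kappa> * fps_X) * (fps_const a - fps_const l * fps_X) * fps_dilate q G
      + fps_const b * (1 - fps_const \<kappa> * fps_X) * (1 - fps_const (\<kappa> * q) * fps_X)
        * fps_dilate q (fps_dilate q G)
      = fps_const c"
    (is "?lhs = _")
proof -
  define K U K' U' where "K = 1 - fps_const \<kappa> * fps_X" and "U = 1 - fps_const u * fps_X"
    and "K' = 1 - fps_const (\<kappa> * q) * fps_X" and "U' = 1 - fps_const (u * q) * fps_X"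
  have dil: "fps_dilate q K = K'" "fps_dilate q U = U'"
    by (simp_all add: K_def K'_def U_def U'_def fps_dilate_diff fps_dilate_mult flip: fps_const_mult)
  have W1: "K * fps_dilate q W = U * W"
    using W by (simp add: K_def U_def)
  \<comment> \<open>Dilating the first-order equation once more reaches the second dilation of
    \<open>W\<close>; combined with \<open>W1\<close>, it expresses that in terms of
    \<open>W\<close> itself.\<close>
  have W2: "K' * fps_dilate q (fps_dilate q W) = U' * fps_dilate q W"
    using arg_cong[OF W1, of "fps_dilate q"] by (simp add: fps_dilate_mult dil)
  have W3: "K * (K' * fps_dilate q (fps_dilate q W)) = U * U' * W"
    unfolding W2 using W1 by (metis mult.commute mult.left_commute)
  have "?lhs = U * (1 - fps_const v * fps_X) * (W * F)
      - (fps_const a - fps_const l * fps_X) * ((K * fps_dilate q W) * fps_dilate q F)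
      + fps_const b * ((K * (K' * fps_dilate q (fps_dilate q W))) * fps_dilate q (fps_dilate q F))"
    by (simp add: G_def fps_dilate_mult K_def K'_def U_def mult_ac)
  also have "\<dots> = U * W * ((1 - fps_const v * fps_X) * F
      - (fps_const a - fps_const l * fps_X) * fps_dilate q F
      + fps_const b * U' * fps_dilate q (fps_dilate q F))"
    unfolding W1 W3 by (simp add: algebra_simps)
  also have "\<dots> = fps_const c * (U * W * V)"
    using F by (simp add: U'_def mult_ac)
  also have "\<dots> = fps_const c"
    using V by (simp add: U_def)
  finally show ?thesis .
qed

lemma fps_linear_times_nth_Suc:
  fixes a b :: "'a::comm_ring_1"
  shows "fps_nth ((fps_const a - fps_const b * fps_X) * F) (Suc n)
     = a * fps_nth F (Suc n) - b * fps_nth F n"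
  by (simp add: left_diff_distrib mult.assoc)

lemma fps_one_minus_linear_times_nth_Suc:
  fixes b :: "'a::comm_ring_1"
  shows "fps_nth ((1 - fps_const b * fps_X) * F) (Suc n) = fps_nth F (Suc n) - b * fps_nth F n"
  using fps_linear_times_nth_Suc[of 1 b F n] by (simp del: fps_mult_nth)

text \<open>The ratio of consecutive coefficients is \<kappa>
  \<open>(1 - \<delta> q^m) / (1 - q^(m+1))\<close>; clearing the denominator turns powers of
  \<open>q\<close> into dilations. The relation between \<kappa>, \<delta> and \<open>u\<close>
  makes this the functional equation of the quotient of infinite products with arguments
  \<open>u q t\<close> and \<kappa> \<open>t\<close>.\<close>

lemma q_binomial_series_functional_equation:
  fixes q \<kappa> \<delta> u :: complex
  assumes "norm q < 1" and "\<kappa> * \<delta> = u * q"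
  defines "V \<equiv> Abs_fps (\<lambda>n. qpoch q \<delta> n / qpoch q q n * \<kappa> ^ n)"
  shows "(1 - fps_const \<kappa> * fps_X) * V = (1 - fps_const (u * q) * fps_X) * fps_dilate q V"
proof (rule fps_ext)
  fix n
  show "fps_nth ((1 - fps_const \<kappa> * fps_X) * V) n
      = fps_nth ((1 - fps_const (u * q) * fps_X) * fps_dilate q V) n"
  proof (cases n)
    case (Suc m)
    define g h where "g = fps_nth V m" and "h = fps_nth V (Suc m)"
    have "1 - q * q ^ m \<noteq> 0"
      using power_neq_one[OF assms(1), of "Suc m"] by simp
    then have "(1 - q * q ^ m) * h = \<kappa> * (1 - \<delta> * q ^ m) * g"
      by (simp add: V_def g_def h_def qpoch_Suc)
    also have "\<dots> = (\<kappa> - u * q * q ^ m) * g"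
      by (simp add: right_diff_distrib mult.assoc flip: assms(2))
    finally show ?thesis
      unfolding Suc fps_one_minus_linear_times_nth_Suc fps_dilate_nth g_def[symmetric] h_def[symmetric]
      by (simp add: algebra_simps)
  qed simp
qed

section \<open>The double sum: first-order recurrence and q-difference equation\<close>

text \<open>Raising \<open>n\<close> multiplies every summand with \<open>j\<close> at most
  \<open>n\<close> by one factor independent of \<open>j\<close>. The only new summand,
  \<open>j = n + 1\<close>, supplies the inhomogeneity.\<close>

lemma double_sum_recurrence:
  fixes q A D \<beta> \<gamma> \<delta> \<kappa> u :: complex
  assumes "q \<noteq> 0" and "u \<noteq> 0"
    and A: "\<And>k::nat. A \<noteq> 1 / q ^ k" and D: "\<And>k::nat. D \<noteq> 1 / q ^ k"
  defines "f \<equiv> \<lambda>n. \<Sum>j\<le>n. qpoch_ratio q \<beta> n j * qpoch_ratio q \<gamma> n j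
               / (qpoch q A n * qpoch q D n)
             * (qpoch q (A / q) j * qpoch q (D / q) j * qpoch q \<delta> j / qpoch q q j)
             * \<kappa> ^ j * u powi (int j - int n)"
  shows "(1 - A * q ^ n) * (1 - D * q ^ n) * f (Suc n)
      = (1 - \<beta> * q ^ n) * (1 - \<gamma> * q ^ n) / u * f n
        + (1 - A / q) * (1 - D / q) * (qpoch q \<delta> (Suc n) / qpoch q q (Suc n) * \<kappa> ^ Suc n)"
proof -
  define T where "T m j = qpoch_ratio q \<beta> m j * qpoch_ratio q \<gamma> m j
               / (qpoch q A m * qpoch q D m)
             * (qpoch q (A / q) j * qpoch q (D / q) j * qpoch q \<delta> j / qpoch q q j)
             * \<kappa> ^ j * u powi (int j - int m)" for m j
  define e where "e = (1 - A * q ^ n) * (1 - D * q ^ n)"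
  have nz: "qpoch q A m \<noteq> 0" "qpoch q D m \<noteq> 0" for m
    using qpoch_nonzero[OF assms(1)] A D by blast+
  then have nz': "1 - A * q ^ n \<noteq> 0" "1 - D * q ^ n \<noteq> 0"
    by (metis mult_zero_right qpoch_Suc)+
  have step: "e * T (Suc n) j = (1 - \<beta> * q ^ n) * (1 - \<gamma> * q ^ n) / u * T n j" if "j \<le> n" for j
  proof -
    have "u powi (int j - int (Suc n)) = u powi (int j - int n) / u"
      using \<open>u \<noteq> 0\<close> power_int_diff[of u "int j - int n" 1] by (simp add: algebra_simps)
    then show ?thesis
      using nz' by (simp add: T_def e_def qpoch_ratio_Suc[OF that] qpoch_Suc mult_ac)
  qed
  \<comment> \<open>On the diagonal both ratios and the power of \<open>u\<close> are 1, and the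
    factorials starting at \<open>A / q\<close> and \<open>D / q\<close> cancel those of
    \<open>A\<close> and \<open>D\<close> except for their first factors.\<close>
  have last: "e * T (Suc n) (Suc n)
      = (1 - A / q) * (1 - D / q) * (qpoch q \<delta> (Suc n) / qpoch q q (Suc n) * \<kappa> ^ Suc n)"
  proof -
    have shift: "qpoch q (a / q) (Suc n) = (1 - a / q) * qpoch q a n" for a
      using \<open>q \<noteq> 0\<close> by (simp add: qpoch_Suc_shift)
    show ?thesis
      using nz[of n] nz' unfolding T_def e_def shift qpoch_Suc[of q A] qpoch_Suc[of q D]
      by (simp add: mult_ac)
  qed
  have "e * f (Suc n) = (\<Sum>j\<le>n. e * T (Suc n) j) + e * T (Suc n) (Suc n)"
    unfolding f_def T_def[symmetric] by (simp add: sum_distrib_left distrib_left)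
  also have "(\<Sum>j\<le>n. e * T (Suc n) j) = (1 - \<beta> * q ^ n) * (1 - \<gamma> * q ^ n) / u * f n"
    unfolding f_def T_def[symmetric] sum_distrib_left by (rule sum.cong) (simp_all add: step)
  finally show ?thesis
    unfolding last by (simp only: e_def)
qed

text \<open>This is the recurrence above in generating-function form: multiplying a coefficient by
  \<open>q ^ n\<close> is a dilation, and lowering the index is multiplication by
  \<open>fps_X\<close>.\<close>

lemma double_sum_qdiff_equation:
  fixes q A D \<beta> \<gamma> \<delta> \<kappa> u :: complex
  assumes "q \<noteq> 0" and "u \<noteq> 0"
    and "\<And>k::nat. A \<noteq> 1 / q ^ k" and "\<And>k::nat. D \<noteq> 1 / q ^ k"
    and \<beta>\<gamma>: "\<beta> * \<gamma> * q = A * D * u\<^sup>2"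
  defines "F \<equiv> Abs_fps (\<lambda>n. \<Sum>j\<le>n. qpoch_ratio q \<beta> n j * qpoch_ratio q \<gamma> n j
               / (qpoch q A n * qpoch q D n)
             * (qpoch q (A / q) j * qpoch q (D / q) j * qpoch q \<delta> j / qpoch q q j)
             * \<kappa> ^ j * u powi (int j - int n))"
  shows "(1 - fps_const (1 / u) * fps_X) * F
      - (fps_const ((A + D) / q) - fps_const ((\<beta> + \<gamma>) / u) * fps_X) * fps_dilate q F
      + fps_const (A * D / q\<^sup>2) * (1 - fps_const (u * q) * fps_X) * fps_dilate q (fps_dilate q F)
      = fps_const ((1 - A / q) * (1 - D / q))
        * Abs_fps (\<lambda>n. qpoch q \<delta> n / qpoch q q n * \<kappa> ^ n)"
    (is "?lhs = ?rhs")
proof (rule fps_ext)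
  fix n
  show "fps_nth ?lhs n = fps_nth ?rhs n"
  proof (cases n)
    case 0
    \<comment> \<open>At index 0 the left side is \<open>1 - (A + D) / q + A D / q^2\<close>, which
      is exactly the constant on the right.\<close>
    have "fps_nth F 0 = 1"
      by (simp add: F_def)
    then show ?thesis
      using assms(1) by (simp add: 0 field_simps power2_eq_square)
  next
    case (Suc m)
    define x y g where "x = fps_nth F (Suc m)" and "y = fps_nth F m"
      and "g = qpoch q \<delta> (Suc m) / qpoch q q (Suc m) * \<kappa> ^ Suc m"
    have rec: "(1 - A * q ^ m) * (1 - D * q ^ m) * x
        = (1 - \<beta> * q ^ m) * (1 - \<gamma> * q ^ m) / u * y + (1 - A / q) * (1 - D / q) * g"
      using double_sum_recurrence[of q u A D m \<beta> \<gamma> \<delta> \<kappa>] assms(1-4)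
      unfolding x_def y_def g_def F_def fps_nth_Abs_fps by blast
    have "fps_nth ?lhs n = x - 1 / u * y
        - ((A + D) / q * (q ^ Suc m * x) - (\<beta> + \<gamma>) / u * (q ^ m * y))
        + A * D / q\<^sup>2 * (q ^ Suc m * (q ^ Suc m * x) - u * q * (q ^ m * (q ^ m * y)))"
      unfolding Suc fps_add_nth fps_sub_nth mult.assoc[of "fps_const _"]
        fps_mult_left_const_nth fps_linear_times_nth_Suc fps_one_minus_linear_times_nth_Suc
        fps_dilate_nth x_def y_def ..
    also have "\<dots> = (1 - A * q ^ m) * (1 - D * q ^ m) * x
        - (1 / u - (\<beta> + \<gamma>) / u * q ^ m + A * D * u / q * (q ^ m)\<^sup>2) * y"
      using \<open>q \<noteq> 0\<close> \<open>u \<noteq> 0\<close> by (simp add: field_simps power2_eq_square)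
    \<comment> \<open>The hypothesis on \<beta> \<gamma> is what allows the twice dilated term to
      carry the factor \<open>1 - u q t\<close> required by the gauge transformation.\<close>
    also have "A * D * u / q = \<beta> * \<gamma> / u"
      using \<open>q \<noteq> 0\<close> \<open>u \<noteq> 0\<close> \<beta>\<gamma> by (simp add: field_simps power2_eq_square)
    also have "(1 / u - (\<beta> + \<gamma>) / u * q ^ m + \<beta> * \<gamma> / u * (q ^ m)\<^sup>2)
        = (1 - \<beta> * q ^ m) * (1 - \<gamma> * q ^ m) / u"
      using \<open>u \<noteq> 0\<close> by (simp add: field_simps power2_eq_square)
    finally show ?thesis
      using rec by (simp add: Suc g_def)
  qed
qed

section \<open>Three-term recurrences for the coefficients of both sides\<close>

text \<open>The coefficients of the equation are quadratic in \<open>t\<close>, so reading it off at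
  index \<open>Suc n\<close> links three consecutive coefficients of \<open>G\<close>; the constant
  right side contributes nothing at a positive index.\<close>

lemma qdiff_equation_coefficients:
  fixes q \<kappa> u v a l b c :: complex
  assumes G: "(1 - fps_const u * fps_X) * (1 - fps_const v * fps_X) * G
      - (1 - fps_const \<kappa> * fps_X) * (fps_const a - fps_const l * fps_X) * fps_dilate q G
      + fps_const b * (1 - fps_const \<kappa> * fps_X) * (1 - fps_const (\<kappa> * q) * fps_X)
        * fps_dilate q (fps_dilate q G)
      = fps_const c"
  shows "(1 - a * q ^ Suc n + b * (q ^ Suc n)\<^sup>2) * fps_nth G (Suc n)
      = (u + v - (l + a * \<kappa>) * q ^ n + b * \<kappa> * (1 + q) * (q ^ n)\<^sup>2) * fps_nth G n
        - (if n = 0 then 0 else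
            (u * v - \<kappa> * l * q ^ (n - 1) + b * \<kappa>\<^sup>2 * q * (q ^ (n - 1))\<^sup>2) * fps_nth G (n - 1))"
proof -
  \<comment> \<open>Reassociating to nested products lets the coefficient rules for linear factors
    peel off one factor at a time.\<close>
  have eq: "fps_nth ((1 - fps_const u * fps_X) * ((1 - fps_const v * fps_X) * G)
      - (1 - fps_const \<kappa> * fps_X) * ((fps_const a - fps_const l * fps_X) * fps_dilate q G)
      + fps_const b * ((1 - fps_const \<kappa> * fps_X) * ((1 - fps_const (\<kappa> * q) * fps_X)
        * fps_dilate q (fps_dilate q G)))) (Suc n) = 0"
    using G by (simp add: mult.assoc del: fps_mult_nth)
  show ?thesis
  proof (cases n)
    case 0
    then show ?thesis
      using eq unfolding fps_add_nth fps_sub_nth fps_mult_left_const_nth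
        fps_linear_times_nth_Suc fps_one_minus_linear_times_nth_Suc
      by (simp add: power2_eq_square algebra_simps)
  next
    case (Suc m)
    then show ?thesis
      using eq unfolding fps_add_nth fps_sub_nth fps_mult_left_const_nth Suc
        fps_linear_times_nth_Suc fps_one_minus_linear_times_nth_Suc
      by (simp add: power2_eq_square algebra_simps)
  qed
qed

text \<open>The normalization by the factorials of \<open>A\<close> and \<open>D\<close> cancels the
  \<open>A\<close>- and \<open>D\<close>-factors of the last term, and the power of
  \<open>2 * \<alpha>\<close> absorbs \<open>1 / (4 \<alpha>^2)\<close>. Only the factors in
  \<open>B\<close> and \<open>C\<close> survive.\<close>

lemma assoc_cdqHahn_normalized_recurrence:
  fixes q A B C D \<alpha> z :: complex
  assumes "q \<noteq> 0" and "\<alpha> \<noteq> 0"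
    and A: "\<And>k::nat. A \<noteq> 1 / q ^ k" and D: "\<And>k::nat. D \<noteq> 1 / q ^ k"
  defines "p \<equiv> \<lambda>n. (2 * \<alpha>) ^ n * assoc_cdqHahn q \<alpha> A B C D n z / (qpoch q A n * qpoch q D n)"
  shows "(1 - A * q ^ n) * (1 - D * q ^ n) * p (Suc n)
      = 2 * \<alpha> * (z - (1 / A + 1 / B + 1 / C + 1 / D) * q ^ n + (1 + q) / q * (q ^ n)\<^sup>2) * p n
        - (if n = 0 then 0 else (1 - B * q ^ (n - 1)) * (1 - C * q ^ (n - 1)) * p (n - 1))"
proof -
  define P where "P n = assoc_cdqHahn q \<alpha> A B C D n z" for n
  have nz: "qpoch q A m \<noteq> 0" "qpoch q D m \<noteq> 0" for m
    using qpoch_nonzero[OF assms(1)] A D by blast+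
  then have nz': "1 - A * q ^ m \<noteq> 0" "1 - D * q ^ m \<noteq> 0" for m
    by (metis mult_zero_right qpoch_Suc)+
  \<comment> \<open>The integer exponent is traded for a division by \<open>q\<close>, which also
    covers \<open>n = 0\<close>, where the exponent is -1.\<close>
  have pw: "q powi (2 * int n - 1) = (q ^ n)\<^sup>2 / q"
    using \<open>q \<noteq> 0\<close> power_int_of_nat[of q "2 * n"]
    by (simp add: power_int_diff power_mult mult.commute)
  define m where "m = z - (1 / A + 1 / B + 1 / C + 1 / D) * q ^ n + (1 + q) / q * (q ^ n)\<^sup>2"
  show ?thesis
  proof (cases n)
    case 0
    have "P (Suc n) = m * P n"
      unfolding P_def assoc_cdqHahn.simps pw m_def by (simp add: 0)
    then show ?thesis
      unfolding m_def[symmetric] p_def P_def[symmetric] using nz'[of 0] by (simp add: 0 qpoch_Suc)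
  next
    case (Suc k)
    define e E b where "e = (1 - A * q ^ k) * (1 - D * q ^ k)"
      and "E = qpoch q A k * qpoch q D k" and "b = (1 - B * q ^ k) * (1 - C * q ^ k)"
    have "e \<noteq> 0" and "E \<noteq> 0"
      using nz nz' by (simp_all add: e_def E_def)
    have Ee: "qpoch q A n * qpoch q D n = E * e"
      by (simp add: Suc E_def e_def qpoch_Suc mult_ac)
    have "P (Suc n) = m * P n - 1 / (4 * \<alpha>\<^sup>2) * (1 - A * q ^ k) * (1 - B * q ^ k)
        * (1 - C * q ^ k) * (1 - D * q ^ k) * P k"
      unfolding P_def assoc_cdqHahn.simps pw m_def by (simp add: Suc)
    also have "\<dots> = m * P n - e * b * P k / (2 * \<alpha>)\<^sup>2"
      by (simp add: e_def b_def power_mult_distrib)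
    finally have P: "P (Suc n) = m * P n - e * b * P k / (2 * \<alpha>)\<^sup>2" .
    have "(1 - A * q ^ n) * (1 - D * q ^ n) * p (Suc n) = (2 * \<alpha>) ^ Suc n * P (Suc n) / (E * e)"
      using nz'[of n] by (simp add: p_def P_def qpoch_Suc[of _ _ n] flip: Ee)
    also have "\<dots> = 2 * \<alpha> * m * ((2 * \<alpha>) ^ n * P n / (E * e)) - b * ((2 * \<alpha>) ^ k * P k / E)"
      unfolding P using \<open>e \<noteq> 0\<close> \<open>E \<noteq> 0\<close> \<open>\<alpha> \<noteq> 0\<close>
      by (simp add: Suc field_simps power2_eq_square)
    also have "\<dots> = 2 * \<alpha> * m * p n - b * p k"
      unfolding Ee[symmetric] by (simp add: p_def P_def E_def)
    finally show ?thesis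
      by (simp add: m_def b_def Suc)
  qed
qed

section \<open>Identification of the two generating functions\<close>

theorem mainTheorem4:
  fixes q A B C D \<alpha> \<theta> x u z :: complex
  assumes "0 < norm q" and "norm q < 1"
    and "A \<noteq> 0" and "B \<noteq> 0" and "C \<noteq> 0" and "D \<noteq> 0"
    and "\<And>k::nat. A \<noteq> 1 / q ^ k" and "\<And>k::nat. D \<noteq> 1 / q ^ k"
    and "(2 * \<alpha>)\<^sup>2 = A * B * C * D / q" \<comment> \<open>either branch of the square root\<close>
    and "x = cos \<theta>" and "u = exp (\<i> * \<theta>)" and "z = x / \<alpha>"
  shows "Abs_fps (\<lambda>n. (2 * \<alpha>) ^ n * assoc_cdqHahn q \<alpha> A B C D n z / (qpoch q A n * qpoch q D n))
       = fps_expansion (\<lambda>t. qpoch_inf q (2 * \<alpha> * t * q / (A * D)) / qpoch_inf q (t * u)) 0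
         * Abs_fps (\<lambda>n. \<Sum>j\<le>n.
             qpoch_ratio q (2 * \<alpha> * u / B) n j * qpoch_ratio q (2 * \<alpha> * u / C) n j
               / (qpoch q A n * qpoch q D n)
             * (qpoch q (A / q) j * qpoch q (D / q) j * qpoch q (A * D * u / (2 * \<alpha>)) j / qpoch q q j)
             * (2 * \<alpha> * q / (A * D)) ^ j * u powi (int j - int n))"
proof -
  define s \<kappa> where "s = 2 * \<alpha>" and "\<kappa> = 2 * \<alpha> * q / (A * D)"
  define W where "W = fps_expansion (\<lambda>t. qpoch_inf q (\<kappa> * t) / qpoch_inf q (u * t)) 0"
  define V where "V = Abs_fps (\<lambda>n. qpoch q (A * D * u / (2 * \<alpha>)) n / qpoch q q n * \<kappa> ^ n)"
  define F where "F = Abs_fps (\<lambda>n. \<Sum>j\<le>n.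
             qpoch_ratio q (2 * \<alpha> * u / B) n j * qpoch_ratio q (2 * \<alpha> * u / C) n j
               / (qpoch q A n * qpoch q D n)
             * (qpoch q (A / q) j * qpoch q (D / q) j * qpoch q (A * D * u / (2 * \<alpha>)) j / qpoch q q j)
             * \<kappa> ^ j * u powi (int j - int n))"
  define G where "G = W * F"
  define p where "p n = (2 * \<alpha>) ^ n * assoc_cdqHahn q \<alpha> A B C D n z / (qpoch q A n * qpoch q D n)"
    for n
  \<comment> \<open>This is the coefficient \<open>(\<beta> + \<gamma>) / u\<close> of the
    q-difference equation of the double sum, with \<beta> and \<gamma> the parameters belonging to
    \<open>B\<close> and \<open>C\<close>.\<close>
  define l where "l = (2 * \<alpha> * u / B + 2 * \<alpha> * u / C) / u"
  have "q \<noteq> 0" and "u \<noteq> 0"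
    using assms by auto
  have s2: "s\<^sup>2 * q = A * B * C * D"
    using assms(9) \<open>q \<noteq> 0\<close> by (simp add: s_def field_simps)
  then have "s \<noteq> 0"
    using assms(3-6) by auto
  then have "\<alpha> \<noteq> 0"
    by (simp add: s_def)
  note nz = \<open>q \<noteq> 0\<close> \<open>u \<noteq> 0\<close> \<open>s \<noteq> 0\<close> assms(3-6)
  have \<kappa>: "\<kappa> = s * q / (A * D)"
    by (simp add: \<kappa>_def s_def)

  have W0: "fps_nth W 0 = 1"
    and W: "(1 - fps_const \<kappa> * fps_X) * fps_dilate q W = (1 - fps_const u * fps_X) * W"
    unfolding W_def using fps_qpoch_inf_quotient[OF assms(2)] by blast+
  have V: "(1 - fps_const \<kappa> * fps_X) * V = (1 - fps_const (u * q) * fps_X) * fps_dilate q V"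
    unfolding V_def using nz \<open>\<alpha> \<noteq> 0\<close>
    by (intro q_binomial_series_functional_equation assms(2)) (simp add: \<kappa>_def)
  have WV: "(1 - fps_const u * fps_X) * W * V = 1"
    by (rule fps_inverse_of_functional_equations[OF assms(2) W V W0]) (simp add: V_def)
  \<comment> \<open>The definition of \<alpha> enters here: it is equivalent to the compatibility
    condition on \<beta> \<gamma>.\<close>
  have "s * u / B * (s * u / C) * q = A * D * u\<^sup>2"
    using nz s2 by (simp add: field_simps power2_eq_square)
  then have F: "(1 - fps_const (1 / u) * fps_X) * F
      - (fps_const ((A + D) / q) - fps_const l * fps_X) * fps_dilate q F
      + fps_const (A * D / q\<^sup>2) * (1 - fps_const (u * q) * fps_X) * fps_dilate q (fps_dilate q F)
      = fps_const ((1 - A / q) * (1 - D / q)) * V"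
    unfolding F_def V_def l_def s_def
    using assms(7,8) nz by (intro double_sum_qdiff_equation) auto
  note G = qdiff_equation_coefficients[OF qdiff_equation_gauge[OF W WV F], folded G_def]

  \<comment> \<open>The next five identities match coefficients with the polynomial recurrence:
    \<open>c1\<close> and \<open>c2\<close> for the terms in \<open>q ^ n\<close> and its square,
    \<open>c3\<close> and \<open>c4\<close> for the expansion of the \<open>B\<close>- and
    \<open>C\<close>-factors, and \<open>c5\<close> for the spectral variable.\<close>
  have c1: "l + (A + D) / q * \<kappa> = s * (1 / A + 1 / B + 1 / C + 1 / D)"
    using nz by (simp add: \<kappa> l_def flip: s_def) (simp add: field_simps)
  have c2: "A * D / q\<^sup>2 * \<kappa> * (1 + q) = s * ((1 + q) / q)"
    using nz by (simp add: \<kappa> power2_eq_square)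
  have c3: "\<kappa> * l = B + C"
  proof -
    have "\<kappa> * l = s\<^sup>2 * q * (1 / B + 1 / C) / (A * D)"
      using nz by (simp add: \<kappa> l_def flip: s_def) (simp add: field_simps power2_eq_square)
    also have "\<dots> = B + C"
      unfolding s2 using nz by (simp add: field_simps)
    finally show ?thesis .
  qed
  have c4: "A * D / q\<^sup>2 * \<kappa>\<^sup>2 * q = B * C"
  proof -
    have "A * D / q\<^sup>2 * \<kappa>\<^sup>2 * q = s\<^sup>2 * q / (A * D)"
      using nz by (simp add: \<kappa> field_simps power2_eq_square)
    then show ?thesis
      using nz by (simp add: s2)
  qed
  have c5: "s * z = u + 1 / u"
  proof -
    have "2 * cos \<theta> = u + 1 / u"
      by (simp add: assms(11) cos_exp_eq exp_minus inverse_eq_divide)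
    then show ?thesis
      using \<open>\<alpha> \<noteq> 0\<close> by (simp add: s_def assms(10,12))
  qed

  have G_rec: "(1 - A * q ^ n) * (1 - D * q ^ n) * fps_nth G (Suc n)
      = 2 * \<alpha> * (z - (1 / A + 1 / B + 1 / C + 1 / D) * q ^ n + (1 + q) / q * (q ^ n)\<^sup>2)
          * fps_nth G n
        - (if n = 0 then 0 else
            (1 - B * q ^ (n - 1)) * (1 - C * q ^ (n - 1)) * fps_nth G (n - 1))" for n
  proof -
    have "(1 - A * q ^ n) * (1 - D * q ^ n)
        = 1 - (A + D) / q * q ^ Suc n + A * D / q\<^sup>2 * (q ^ Suc n)\<^sup>2"
      using nz by (simp add: field_simps power2_eq_square)
    moreover have "2 * \<alpha> * (z - (1 / A + 1 / B + 1 / C + 1 / D) * q ^ n + (1 + q) / q * (q ^ n)\<^sup>2)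
        = u + 1 / u - (l + (A + D) / q * \<kappa>) * q ^ n
          + A * D / q\<^sup>2 * \<kappa> * (1 + q) * (q ^ n)\<^sup>2"
      unfolding c1 c2 c5[symmetric] by (simp only: s_def[symmetric] ring_distribs mult.assoc)
    moreover have "(1 - B * q ^ (n - 1)) * (1 - C * q ^ (n - 1))
        = u * (1 / u) - \<kappa> * l * q ^ (n - 1) + A * D / q\<^sup>2 * \<kappa>\<^sup>2 * q * (q ^ (n - 1))\<^sup>2"
      unfolding c3 c4 using nz by (simp add: algebra_simps power2_eq_square)
    ultimately show ?thesis
      using G[of n] by simp
  qed
  have p_rec: "(1 - A * q ^ n) * (1 - D * q ^ n) * p (Suc n)
      = 2 * \<alpha> * (z - (1 / A + 1 / B + 1 / C + 1 / D) * q ^ n + (1 + q) / q * (q ^ n)\<^sup>2) * p n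
        - (if n = 0 then 0 else (1 - B * q ^ (n - 1)) * (1 - C * q ^ (n - 1)) * p (n - 1))" for n
    unfolding p_def
    by (rule assoc_cdqHahn_normalized_recurrence[OF \<open>q \<noteq> 0\<close> \<open>\<alpha> \<noteq> 0\<close> assms(7,8)])
  have nz': "(1 - A * q ^ n) * (1 - D * q ^ n) \<noteq> 0" for n
    using assms(7,8)[of n] \<open>q \<noteq> 0\<close> by (simp add: eq_divide_eq)

  \<comment> \<open>Both sequences start at 1 and obey the same recurrence, whose leading factor
    never vanishes. Strong induction is needed because two previous values enter; at
    \<open>m = 0\<close> the second of them drops out.\<close>
  have "p n = fps_nth G n" for n
  proof (induction n rule: less_induct)
    case (less n)
    show ?case
    proof (cases n)
      case 0
      then show ?thesis
        by (simp add: p_def G_def F_def W0)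
    next
      case (Suc m)
      have "(1 - A * q ^ m) * (1 - D * q ^ m) * p (Suc m)
          = (1 - A * q ^ m) * (1 - D * q ^ m) * fps_nth G (Suc m)"
        unfolding p_rec G_rec using less.IH[of m] less.IH[of "m - 1"] Suc by simp
      then show ?thesis
        using nz'[of m] Suc by (metis mult_left_cancel)
    qed
  qed
  then have "Abs_fps p = G"
    by (intro fps_ext) simp
  moreover have "W = fps_expansion (\<lambda>t. qpoch_inf q (2 * \<alpha> * t * q / (A * D)) / qpoch_inf q (t * u)) 0"
    by (simp add: W_def \<kappa>_def mult_ac)
  ultimately show ?thesis
    unfolding p_def G_def F_def \<kappa>_def by simp
qed

end
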